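(* Assume that $\lambda=n+1$ with $n\in\mathbb{N}_0$. Then there exists a polynomial $p_n(t,ik)$, of degree $n$ in both $t$ and $k$, such that $$e_\pm(x,k)=A_n^\pm(k)\,p_n(\tanh x,ik)\,e^{ikx},$$ where $k>0$ for the sign $+$ and $k<0$ for the sign $-$. Furthermore the following holds: (1) The constant $A_n^\pm(k)$ is given by $$A_n^+(k)=\prod_{j=1}^n\frac{1}{j+ik}\qquad\text{and}\qquad A_n^-(k)=(-1)^n\prod_{j=1}^n\frac{1}{j-ik}.$$ (2) The transmission coefficients $T_\pm(k)$ are $$T_+(k)=(-1)^n\prod_{j=1}^n\frac{j-ik}{j+ik}\qquad\text{and}\qquad T_-(k)=(-1)^n\prod_{j=1}^n\frac{j+ik}{j-ik}.$$ (3) The reflection coefficients $R_\pm(k)$ are all zero.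
   Context: Let $V(x)=-\lambda(\lambda-1)\,\mathrm{sech}^2x$ and $H=-d^2/dx^2+V$ on $\mathbb{R}$. For real $k\neq 0$, $e_\pm(x,k)$ ($\pm$ being the sign of $k$) is the solution of $He_\pm(\cdot,k)=k^2e_\pm(\cdot,k)$ with asymptotics $$e_\pm(x,k)\sim T_\pm(k)e^{ikx}\ \text{ as }x\to\pm\infty,\qquad e_\pm(x,k)\sim e^{ikx}+R_\pm(k)e^{-ikx}\ \text{ as }x\to\mp\infty;$$ $T_\pm(k)$ and $R_\pm(k)$ are called the transmission and reflection coefficients. Equivalently, $e_\pm$ solves the Lippmann--Schwinger equation $e_\pm(x,k)=e^{ikx}+\frac{1}{2i|k|}\int e^{i|k||x-y|}V(y)e_\pm(y,k)\,dy$. Empty products equal $1$. *)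

theory Defs
  imports Complex_Main "HOL-Computational_Algebra.Polynomial"
begin

definition poeschl_teller :: "real \<Rightarrow> real \<Rightarrow> real" where
  "poeschl_teller lam x = - lam * (lam - 1) * (1 / cosh x)\<^sup>2"

text \<open>Classical solutions on the whole line of \<open>H f = E f\<close>, where \<open>H = - d\<^sup>2/dx\<^sup>2 + V\<close>.\<close>

definition schroedinger_eigenfunction :: "(real \<Rightarrow> real) \<Rightarrow> real \<Rightarrow> (real \<Rightarrow> complex) \<Rightarrow> bool" where
  "schroedinger_eigenfunction V E f \<longleftrightarrow>
     (\<exists>f' f''. \<forall>x. (f has_vector_derivative f' x) (at x) \<and>
                   (f' has_vector_derivative f'' x) (at x) \<and>
                   - f'' x + of_real (V x) * f x = of_real E * f x)"

definition plane_wave :: "real \<Rightarrow> real \<Rightarrow> complex" where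
  "plane_wave k x = exp (\<i> * of_real k * of_real x)"

text \<open>The filters at which the wave with wave number \<open>k\<close> is respectively transmitted and
  incident; the sign of \<open>k\<close> plays the role of the index \<open>\<plusminus>\<close>.\<close>

definition transmitted_end :: "real \<Rightarrow> real filter" where
  "transmitted_end k = (if k > 0 then at_top else at_bot)"

definition incident_end :: "real \<Rightarrow> real filter" where
  "incident_end k = (if k > 0 then at_bot else at_top)"

text \<open>The asymptotics \<open>f \<sim> g\<close> are read as \<open>f - g \<longlongrightarrow> 0\<close>, since \<open>g\<close> is oscillating and may
  have zeros.\<close>

definition scattering_solution ::
    "real \<Rightarrow> real \<Rightarrow> (real \<Rightarrow> complex) \<Rightarrow> complex \<Rightarrow> complex \<Rightarrow> bool" where
  "scattering_solution lam k f T R \<longleftrightarrow>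
     schroedinger_eigenfunction (poeschl_teller lam) (k\<^sup>2) f \<and>
     ((\<lambda>x. f x - T * plane_wave k x) \<longlongrightarrow> 0) (transmitted_end k) \<and>
     ((\<lambda>x. f x - (plane_wave k x + R * plane_wave (- k) x)) \<longlongrightarrow> 0) (incident_end k)"

text \<open>The three functions below are meaningful for \<open>k \<noteq> 0\<close>; for \<open>k > 0\<close> they are \<open>e\<^sub>+\<close>,
  \<open>T\<^sub>+\<close>, \<open>R\<^sub>+\<close>, and for \<open>k < 0\<close> they are \<open>e\<^sub>-\<close>, \<open>T\<^sub>-\<close>, \<open>R\<^sub>-\<close>.\<close>

definition scattering_wave :: "real \<Rightarrow> real \<Rightarrow> real \<Rightarrow> complex" where
  "scattering_wave lam x k = (THE f. \<exists>T R. scattering_solution lam k f T R) x"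

definition transmission_coeff :: "real \<Rightarrow> real \<Rightarrow> complex" where
  "transmission_coeff lam k = (THE T. \<exists>f R. scattering_solution lam k f T R)"

definition reflection_coeff :: "real \<Rightarrow> real \<Rightarrow> complex" where
  "reflection_coeff lam k = (THE R. \<exists>f T. scattering_solution lam k f T R)"

text \<open>Bivariate polynomials \<open>p(t,s)\<close> are represented as polynomials in \<open>t\<close> whose coefficients
  are polynomials in \<open>s\<close>.\<close>

definition poly2 :: "complex poly poly \<Rightarrow> complex \<Rightarrow> complex \<Rightarrow> complex" where
  "poly2 p t s = poly (poly p [:t:]) s"

definition degree_fst :: "complex poly poly \<Rightarrow> nat" where
  "degree_fst p = degree p"

definition degree_snd :: "complex poly poly \<Rightarrow> nat" where
  "degree_snd p = Max ((\<lambda>i. degree (coeff p i)) ` {..degree p})"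

end

theory Submission
  imports Defs "HOL-Analysis.Derivative"
begin

text \<open>The operator \<open>d/dx - m tanh x\<close> maps solutions of \<open>H f = k\<^sup>2 f\<close> for \<open>\<lambda> = m\<close> to solutions
  for \<open>\<lambda> = m + 1\<close>. Applying it successively for \<open>m = 1, \<dots>, n\<close> to the free wave \<open>e\<^sup>i\<^sup>k\<^sup>x\<close>
  gives the solution \<open>p\<^sub>n(tanh x, ik) e\<^sup>i\<^sup>k\<^sup>x\<close>, whose asymptotics are those of a plane wave with the factor
  \<open>p\<^sub>n(\<plusminus>1, ik) = (ik \<mp> 1) \<dots> (ik \<mp> n)\<close> at \<open>\<plusminus>\<infinity>\<close>; in particular nothing is reflected. The
  solutions for \<open>k\<close> and \<open>-k\<close> have a nonzero Wronskian, so they span the solution space, and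
  comparing the coefficients of \<open>e\<^sup>i\<^sup>k\<^sup>x\<close> and \<open>e\<^sup>-\<^sup>i\<^sup>k\<^sup>x\<close> at both ends determines the scattering
  solution uniquely.\<close>

section \<open>Jost polynomials and their differential equation\<close>

definition t_var :: "complex poly poly" where "t_var = [:0, 1:]"
definition s_var :: "complex poly poly" where "s_var = [:[:0, 1:]:]"

lemma pderiv_vars [simp]: "pderiv t_var = 1" "pderiv s_var = 0"
  by (simp_all add: t_var_def s_var_def pderiv_pCons)

text \<open>One step is \<open>d/dx - (n + 1) tanh x\<close> acting on
  \<open>p(tanh x, s) e^(s x)\<close> with the exponential stripped off; \<open>1 - t^2\<close> is
  the derivative of \<open>tanh\<close>. Up to the factor \<open>(-1)^n n!\<close> these are the
  Jacobi polynomials with parameters \<open>-s\<close> and \<open>s\<close>.\<close>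

primrec jost_poly :: "nat \<Rightarrow> complex poly poly" where
  "jost_poly 0 = 1"
| "jost_poly (Suc n) = (1 - t_var\<^sup>2) * pderiv (jost_poly n)
     + (s_var - of_nat (Suc n) * t_var) * jost_poly n"

text \<open>This is the eigenvalue equation for \<open>p\<^sub>n(tanh x, s) e\<^sup>s\<^sup>x\<close> in the variable \<open>t = tanh x\<close>, after
  division by \<open>1 - t\<^sup>2\<close>.\<close>

lemma jost_poly_ode:
  "(1 - t_var\<^sup>2) * pderiv (pderiv (jost_poly n)) + 2 * (s_var - t_var) * pderiv (jost_poly n)
     + of_nat (n * Suc n) * jost_poly n = 0"
proof (induction n)
  case 0
  then show ?case by simp
next
  case (Suc n)
  define P where "P = jost_poly n"
  define m :: "complex poly poly" where "m = of_nat (Suc n)"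
  define t where "t = t_var"
  define s where "s = s_var"
  have [simp]: "pderiv t = 1" "pderiv s = 0" "pderiv m = 0"
    by (simp_all add: t_def s_def m_def del: of_nat_Suc)
  have ode: "(1 - t\<^sup>2) * pderiv (pderiv P) + 2 * (s - t) * pderiv P + (m - 1) * m * P = 0"
    using Suc unfolding P_def m_def t_def s_def by (simp add: algebra_simps)
  have Q: "jost_poly (Suc n) = (1 - t\<^sup>2) * pderiv P + (s - m * t) * P"
    by (simp add: P_def m_def t_def s_def)
  \<comment> \<open>The equation for \<open>P\<close> removes the second derivative, so
    \<open>Q'\<close> is again of first order in \<open>P\<close>. This keeps \<open>Q''\<close> of
    second order.\<close>
  have Q': "pderiv (jost_poly (Suc n)) = - (s + m * t) * pderiv P - m\<^sup>2 * P"
  proof -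
    have "pderiv (jost_poly (Suc n)) = (1 - t\<^sup>2) * pderiv (pderiv P) - 2 * t * pderiv P
        + (s - m * t) * pderiv P - m * P"
      unfolding Q by (simp add: pderiv_add pderiv_mult pderiv_diff power2_eq_square algebra_simps)
    then show ?thesis using ode by algebra
  qed
  have Q'': "pderiv (pderiv (jost_poly (Suc n))) = - (s + m * t) * pderiv (pderiv P) - (m + m\<^sup>2) * pderiv P"
    unfolding Q' by (simp add: pderiv_add pderiv_mult pderiv_diff pderiv_minus power2_eq_square algebra_simps)
  \<comment> \<open>After substitution the left side is exactly \<open>-(s + m t)\<close> times the
    left side of \<open>ode\<close>.\<close>
  have "(1 - t\<^sup>2) * pderiv (pderiv (jost_poly (Suc n))) + 2 * (s - t) * pderiv (jost_poly (Suc n))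
     + m * (m + 1) * jost_poly (Suc n) = 0"
    unfolding Q'' unfolding Q' unfolding Q using ode by algebra
  then show ?case unfolding t_def s_def m_def by (simp add: algebra_simps)
qed

section \<open>Evaluation of bivariate polynomials\<close>

lemma poly2_simps [simp]:
  "poly2 0 t s = 0" "poly2 1 t s = 1"
  "poly2 (p + q) t s = poly2 p t s + poly2 q t s"
  "poly2 (p - q) t s = poly2 p t s - poly2 q t s"
  "poly2 (p * q) t s = poly2 p t s * poly2 q t s"
  "poly2 (p ^ n) t s = poly2 p t s ^ n"
  "poly2 (of_nat n) t s = of_nat n"
  "poly2 (numeral w) t s = numeral w"
  "poly2 t_var t s = t" "poly2 s_var t s = s"
  by (simp_all add: poly2_def poly_power t_var_def s_var_def)

lemma poly2_pCons: "poly2 (pCons a p) t s = poly a s + t * poly2 p t s"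
  by (simp add: poly2_def)

lemma DERIV_poly2: "((\<lambda>t. poly2 p t s) has_field_derivative poly2 (pderiv p) t s) (at t)"
proof (induction p)
  case 0
  then show ?case by simp
next
  case (pCons a p)
  show ?case
    by (auto simp: poly2_pCons pderiv_pCons intro!: derivative_eq_intros pCons.IH)
qed

lemma tendsto_poly2:
  assumes "(f \<longlongrightarrow> l) F"
  shows "((\<lambda>x. poly2 p (f x) s) \<longlongrightarrow> poly2 p l s) F"
  using DERIV_isCont[OF DERIV_poly2] assms by (rule isCont_tendsto_compose)

text \<open>At \<open>t = 1\<close>, as at \<open>t = -1\<close> below, the factor
  \<open>1 - t^2\<close> kills the derivative term, so the recursion collapses to a product.\<close>

lemma poly2_jost_poly_1: "poly2 (jost_poly n) 1 s = (\<Prod>j=1..n. s - of_nat j)"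
  by (induction n) (simp_all add: mult.commute)

lemma poly2_jost_poly_minus_1: "poly2 (jost_poly n) (-1) s = (\<Prod>j=1..n. s + of_nat j)"
  by (induction n) (simp_all add: mult.commute)

section \<open>Coefficients and degrees of the Jost polynomials\<close>

lemma coeff_jost_poly_Suc:
  "coeff (jost_poly (Suc n)) i =
     of_nat (Suc i) * coeff (jost_poly n) (Suc i) + [:0, 1:] * coeff (jost_poly n) i
     - (if i = 0 then 0 else of_nat (i + n) * coeff (jost_poly n) (i - 1))"
proof -
  define P where "P = jost_poly n"
  \<comment> \<open>\<open>pCons 0\<close> is multiplication by \<open>t\<close>. The contributions
    of the coefficient at \<open>i - 1\<close> are \<open>i - 1\<close> from \<open>t^2 p'\<close>
    and \<open>n + 1\<close> from \<open>(n + 1) t p\<close>, whence \<open>i + n\<close>.\<close>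
  have expand: "jost_poly (Suc n) = pderiv P - pCons 0 (pCons 0 (pderiv P)) + smult [:0, 1:] P
      - of_nat (Suc n) * pCons 0 P"
    by (simp add: P_def t_var_def s_var_def power2_eq_square algebra_simps del: of_nat_Suc)
  have "coeff (of_nat k * p) j = of_nat k * coeff p j" for k j and p :: "complex poly poly"
    by (simp add: of_nat_poly)
  then show ?thesis
    unfolding expand P_def[symmetric]
    by (auto simp: coeff_pCons coeff_pderiv algebra_simps split: nat.split)
qed

text \<open>The first two facts give the degree in \<open>t\<close>, the last two the degree in
  \<open>s\<close>. They are proved in one induction because its step for each of the middle two and
  the last draws on another fact or on the bound itself.\<close>

lemma coeff_jost_poly:
  shows coeff_jost_poly_eq_0: "i > n \<Longrightarrow> coeff (jost_poly n) i = 0"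
    and coeff_jost_poly_top: "coeff (jost_poly n) n \<noteq> 0"
    and degree_coeff_jost_poly: "degree (coeff (jost_poly n) i) \<le> n"
    and coeff_jost_poly_0: "coeff (coeff (jost_poly n) 0) n = 1"
proof -
  have of_nat_deg: "degree (of_nat k * q) \<le> n" if "degree q \<le> n" for k n and q :: "complex poly"
    using that degree_smult_le[of "of_nat k" q] by (simp add: of_nat_poly)
  have "(\<forall>i>n. coeff (jost_poly n) i = 0) \<and> coeff (jost_poly n) n \<noteq> 0 \<and>
    (\<forall>i. degree (coeff (jost_poly n) i) \<le> n) \<and> coeff (coeff (jost_poly n) 0) n = 1"
  proof (induction n)
    case 0
    then show ?case by (auto simp: coeff_1)
  next
    case (Suc n)
    then have zero: "\<And>i. i > n \<Longrightarrow> coeff (jost_poly n) i = 0"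
      and top: "coeff (jost_poly n) n \<noteq> 0"
      and deg: "\<And>i. degree (coeff (jost_poly n) i) \<le> n"
      and one: "coeff (coeff (jost_poly n) 0) n = 1" by auto
    have "degree (coeff (jost_poly (Suc n)) i) \<le> Suc n" for i
    proof -
      have "degree (of_nat k * coeff (jost_poly n) j) \<le> Suc n" for k j
        using deg[of j] by (intro of_nat_deg) simp
      moreover have "degree ([:0, 1:] * coeff (jost_poly n) i) \<le> Suc n"
        using deg[of i] degree_mult_le[of "[:0, 1:]" "coeff (jost_poly n) i"] by simp
      ultimately show ?thesis
        unfolding coeff_jost_poly_Suc by (intro degree_diff_le degree_add_le) (auto simp del: of_nat_add of_nat_Suc)
    qed
    moreover have "coeff (jost_poly (Suc n)) i = 0" if "i > Suc n" for i
      unfolding coeff_jost_poly_Suc using that by (auto simp: zero)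
    moreover have "coeff (jost_poly (Suc n)) (Suc n) \<noteq> 0"
    proof -
      \<comment> \<open>Only the shifted term reaches the new top degree, so the leading coefficient
        is multiplied by \<open>-(2 n + 1)\<close>.\<close>
      have "coeff (jost_poly (Suc n)) (Suc n) = - (of_nat (Suc n + n) * coeff (jost_poly n) n)"
        unfolding coeff_jost_poly_Suc by (auto simp: zero)
      then show ?thesis using top by (simp del: of_nat_add of_nat_Suc add: of_nat_eq_0_iff)
    qed
    \<comment> \<open>The power \<open>s^(n+1)\<close> can only come from multiplication by
      \<open>s\<close>: the other term, the coefficient of \<open>t\<close>, has degree at most
      \<open>n\<close> in \<open>s\<close>.\<close>
    moreover have "coeff (coeff (jost_poly (Suc n)) 0) (Suc n) = 1"
      using deg[of 1] one unfolding coeff_jost_poly_Suc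
      by (simp add: coeff_eq_0)
    ultimately show ?case by auto
  qed
  then show "i > n \<Longrightarrow> coeff (jost_poly n) i = 0" "coeff (jost_poly n) n \<noteq> 0"
    "degree (coeff (jost_poly n) i) \<le> n" "coeff (coeff (jost_poly n) 0) n = 1" by auto
qed

lemma degree_fst_jost_poly: "degree_fst (jost_poly n) = n"
  unfolding degree_fst_def
  by (intro antisym degree_le le_degree) (auto simp: coeff_jost_poly_eq_0 coeff_jost_poly_top)

text \<open>The maximum is attained at the coefficient of \<open>t^0\<close>, which is monic of
  degree \<open>n\<close> in \<open>s\<close>.\<close>

lemma degree_snd_jost_poly: "degree_snd (jost_poly n) = n"
proof -
  have "degree (coeff (jost_poly n) 0) = n"
    by (intro antisym degree_coeff_jost_poly le_degree) (simp add: coeff_jost_poly_0)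
  then show ?thesis
    unfolding degree_snd_def
    by (intro Max_eqI) (auto simp: degree_coeff_jost_poly intro!: rev_image_eqI[of 0])
qed

section \<open>Plane waves with amplitude polynomial in tanh\<close>

definition tanh_wave :: "complex poly poly \<Rightarrow> real \<Rightarrow> real \<Rightarrow> complex" where
  "tanh_wave p k x = poly2 p (of_real (tanh x)) (\<i> * of_real k) * plane_wave k x"

lemma has_vector_derivative_plane_wave:
  "(plane_wave k has_vector_derivative \<i> * of_real k * plane_wave k x) (at x)"
proof -
  have "((\<lambda>z. exp (\<i> * of_real k * z)) has_field_derivative
      \<i> * of_real k * exp (\<i> * of_real k * of_real x)) (at (of_real x))"
    by (auto intro!: derivative_eq_intros)
  from has_vector_derivative_real_field[OF this] show ?thesis
    by (simp add: plane_wave_def [abs_def] o_def)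
qed

text \<open>Such waves are closed under \<open>d/dx\<close>, which acts on the polynomial as
  \<open>(1 - t^2) d/dt + s\<close>. Differential identities thus become polynomial ones.\<close>

lemma has_vector_derivative_tanh_wave:
  "(tanh_wave p k has_vector_derivative
      tanh_wave ((1 - t_var\<^sup>2) * pderiv p + s_var * p) k x) (at x)"
proof -
  have "((\<lambda>x. tanh x :: real) has_field_derivative (1 - (tanh x)\<^sup>2)) (at x)"
    by (auto intro!: derivative_eq_intros)
  then have "((\<lambda>x. complex_of_real (tanh x)) has_vector_derivative of_real (1 - (tanh x)\<^sup>2)) (at x)"
    by (intro has_vector_derivative_of_real) (simp add: has_real_derivative_iff_has_vector_derivative)
  from field_vector_diff_chain_at[OF this DERIV_poly2]
  have "((\<lambda>x. poly2 p (of_real (tanh x)) (\<i> * of_real k)) has_vector_derivative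
      of_real (1 - (tanh x)\<^sup>2) * poly2 (pderiv p) (of_real (tanh x)) (\<i> * of_real k)) (at x)"
    by (simp add: o_def)
  from has_vector_derivative_mult[OF this has_vector_derivative_plane_wave]
  show ?thesis
    unfolding tanh_wave_def [abs_def]
    by (rule has_vector_derivative_eq_rhs) (simp add: algebra_simps)
qed

section \<open>Wronskians and the solution space\<close>

definition solves_with_deriv :: "(real \<Rightarrow> complex) \<Rightarrow> (real \<Rightarrow> complex) \<Rightarrow> (real \<Rightarrow> complex) \<Rightarrow> bool" where
  "solves_with_deriv q f f' \<longleftrightarrow>
     (\<forall>x. (f has_vector_derivative f' x) (at x) \<and> (f' has_vector_derivative q x * f x) (at x))"

text \<open>Passing to \<open>f'' = q f\<close> with \<open>q = V - E\<close> and a named first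
  derivative makes Wronskians expressible.\<close>

lemma schroedinger_eigenfunction_iff:
  "schroedinger_eigenfunction V E f \<longleftrightarrow> (\<exists>f'. solves_with_deriv (\<lambda>x. of_real (V x - E)) f f')"
proof
  assume "schroedinger_eigenfunction V E f"
  then obtain f' f'' where f: "\<And>x. (f has_vector_derivative f' x) (at x)"
    "\<And>x. (f' has_vector_derivative f'' x) (at x)"
    "\<And>x. - f'' x + of_real (V x) * f x = of_real E * f x"
    unfolding schroedinger_eigenfunction_def by blast
  have "f'' = (\<lambda>x. of_real (V x - E) * f x)"
    using f(3) by (auto simp: algebra_simps add_eq_0_iff2)
  with f show "\<exists>f'. solves_with_deriv (\<lambda>x. of_real (V x - E)) f f'"
    unfolding solves_with_deriv_def by auto
next
  assume "\<exists>f'. solves_with_deriv (\<lambda>x. of_real (V x - E)) f f'"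
  then obtain f' where "solves_with_deriv (\<lambda>x. of_real (V x - E)) f f'" ..
  then show "schroedinger_eigenfunction V E f"
    unfolding solves_with_deriv_def schroedinger_eigenfunction_def
    by (intro exI[of _ f'] exI[of _ "\<lambda>x. of_real (V x - E) * f x"]) (auto simp: algebra_simps)
qed

text \<open>In the derivative the products \<open>f' g'\<close> cancel, and
  \<open>f q g - q f g = 0\<close> because both functions share the same \<open>q\<close>.\<close>

lemma wronskian_const:
  assumes "solves_with_deriv q f f'" "solves_with_deriv q g g'"
  obtains c where "\<And>x. f x * g' x - f' x * g x = c"
proof (rule has_vector_derivative_zero_constant[of UNIV "\<lambda>x. f x * g' x - f' x * g x"])
  fix x
  have f: "(f has_vector_derivative f' x) (at x)" "(f' has_vector_derivative q x * f x) (at x)"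
   and g: "(g has_vector_derivative g' x) (at x)" "(g' has_vector_derivative q x * g x) (at x)"
    using assms by (auto simp: solves_with_deriv_def)
  show "((\<lambda>x. f x * g' x - f' x * g x) has_vector_derivative 0) (at x)"
    by (rule has_vector_derivative_eq_rhs, (rule has_vector_derivative_diff has_vector_derivative_mult f g)+)
       (simp add: algebra_simps)
qed (use that in auto)

lemma solution_span:
  assumes f: "solves_with_deriv q f f'" and g: "solves_with_deriv q g g'"
    and h: "solves_with_deriv q h h'" and W: "f x0 * g' x0 - f' x0 * g x0 \<noteq> 0"
  obtains a b where "\<And>x. h x = a * f x + b * g x"
proof -
  obtain A where A: "\<And>x. h x * f' x - h' x * f x = A" using wronskian_const[OF h f] by blast
  obtain B where B: "\<And>x. h x * g' x - h' x * g x = B" using wronskian_const[OF h g] by blast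
  obtain C where C: "\<And>x. f x * g' x - f' x * g x = C" using wronskian_const[OF f g] by blast
  have C0: "C \<noteq> 0" using W C by simp
  show ?thesis
  proof
    fix x
    \<comment> \<open>Cramer's rule:
      \<open>h (f g' - f' g) = (h g' - h' g) f - (h f' - h' f) g\<close> holds identically, and all
      three brackets are constant.\<close>
    have "h x * C = B * f x - A * g x"
      unfolding A[of x, symmetric] B[of x, symmetric] C[of x, symmetric] by (simp add: algebra_simps)
    then show "h x = (B / C) * f x + (- A / C) * g x"
      using C0 by (simp add: field_simps)
  qed
qed

lemma solves_with_deriv_cmult:
  assumes "solves_with_deriv q f f'"
  shows "solves_with_deriv q (\<lambda>x. c * f x) (\<lambda>x. c * f' x)"
  using assms unfolding solves_with_deriv_def
  by (auto intro!: derivative_eq_intros simp: algebra_simps)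

text \<open>The combination is periodic, so it vanishes identically if it tends to zero at one end.\<close>

lemma plane_wave_combination_tendsto_0:
  assumes k: "k \<noteq> 0" and F: "F = at_top \<or> F = at_bot"
    and lim: "((\<lambda>x. a * plane_wave k x + b * plane_wave (- k) x) \<longlongrightarrow> 0) F"
  shows "a = 0 \<and> b = 0"
proof -
  define f where "f = (\<lambda>x. a * plane_wave k x + b * plane_wave (- k) x)"
  define T where "T = 2 * pi / \<bar>k\<bar>"
  have T: "T > 0" using k by (simp add: T_def)
  \<comment> \<open>The sign \<open>\<sigma>\<close> is \<open>1\<close> or \<open>-1\<close>, so
    that whole multiples of the common period \<open>T\<close> run to the end
    \<open>F\<close>.\<close>
  obtain \<sigma> :: int where \<sigma>: "filterlim (\<lambda>m. real_of_int \<sigma> * real m * T) F sequentially"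
  proof -
    have top: "filterlim (\<lambda>m. real m * T) at_top sequentially"
      using T by (intro filterlim_at_top_mult_tendsto_pos[OF tendsto_const _ filterlim_real_sequentially])
    then have bot: "filterlim (\<lambda>m. - (real m * T)) at_bot sequentially"
      by (simp add: filterlim_uminus_at_bot)
    show thesis
    proof (cases "F = at_top")
      case True
      then show thesis using that[of 1] top by simp
    next
      case False
      then show thesis using that[of "-1"] bot F by simp
    qed
  qed
  have per: "plane_wave l (x + real_of_int \<sigma> * real m * T) = plane_wave l x" if "\<bar>l\<bar> = \<bar>k\<bar>" for l x m
  proof -
    define e :: int where "e = (if l > 0 then 1 else -1)"
    have "l = of_int e * \<bar>k\<bar>"
      using that by (auto simp: e_def)
    then have "l * (real_of_int \<sigma> * real m * T) = 2 * of_int (e * \<sigma> * int m) * pi"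
      using k by (simp add: T_def)
    then have "cis (l * (real_of_int \<sigma> * real m * T)) = 1"
      by (metis (no_types) Ints_of_int cis_multiple_2pi mult.assoc mult.commute)
    then have "exp (\<i> * of_real l * of_real (real_of_int \<sigma> * real m * T)) = 1"
      by (simp only: cis_conv_exp of_real_mult mult.assoc)
    then show ?thesis
      unfolding plane_wave_def of_real_add distrib_left exp_add by simp
  qed
  have "f x = 0" for x
  proof -
    have "filterlim (\<lambda>m. x + real_of_int \<sigma> * real m * T) F sequentially"
      using F \<sigma> by (auto simp: filterlim_tendsto_add_at_top_iff[OF tendsto_const]
          filterlim_tendsto_add_at_bot_iff[OF tendsto_const])
    from filterlim_compose[OF lim[folded f_def] this]
    have "((\<lambda>m. f x) \<longlongrightarrow> 0) sequentially"
      by (simp add: f_def per)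
    then show ?thesis by (simp add: tendsto_const_iff)
  qed
  \<comment> \<open>The value at \<open>0\<close> gives \<open>a + b = 0\<close>; a quarter period
    away the two waves are \<open>\<i>\<close> and \<open>-\<i>\<close>, which gives
    \<open>a - b = 0\<close>.\<close>
  then have "f 0 = 0" "f (pi / (2 * k)) = 0" by auto
  moreover have "plane_wave k (pi / (2 * k)) = \<i>" "plane_wave (- k) (pi / (2 * k)) = - \<i>"
    using k by (simp_all add: plane_wave_def cis_conv_exp[symmetric] complex_eq_iff exp_eq_polar)
  ultimately show ?thesis
    by (simp add: f_def plane_wave_def[of _ 0] complex_eq_iff)
qed


lemma tanh_wave_asymptotics:
  assumes "(tanh \<longlongrightarrow> \<tau>) F"
  shows "((\<lambda>x. tanh_wave p k x - poly2 p (of_real \<tau>) (\<i> * of_real k) * plane_wave k x) \<longlongrightarrow> 0) F"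
proof -
  let ?P = "\<lambda>t. poly2 p (of_real t) (\<i> * of_real k)"
  have lim: "((\<lambda>x. ?P (tanh x) - ?P \<tau>) \<longlongrightarrow> 0) F"
    using tendsto_poly2[OF tendsto_of_real[OF assms], of p "\<i> * of_real k"] by (simp add: LIM_zero)
  \<comment> \<open>A plane wave has modulus one, so convergence of the amplitude suffices.\<close>
  have norm: "norm (plane_wave k x) = 1" for x
    by (simp add: plane_wave_def norm_exp_eq_Re)
  have "((\<lambda>x. (?P (tanh x) - ?P \<tau>) * plane_wave k x) \<longlongrightarrow> 0) F"
    by (rule tendsto_0_le[OF lim, where K = 1]) (simp add: norm_mult norm)
  then show ?thesis
    by (simp add: tanh_wave_def algebra_simps)
qed

section \<open>Jost waves and their Wronskian\<close>

definition jost_wave :: "nat \<Rightarrow> real \<Rightarrow> real \<Rightarrow> complex" where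
  "jost_wave n = tanh_wave (jost_poly n)"

definition jost_wave_deriv :: "nat \<Rightarrow> real \<Rightarrow> real \<Rightarrow> complex" where
  "jost_wave_deriv n = tanh_wave ((1 - t_var\<^sup>2) * pderiv (jost_poly n) + s_var * jost_poly n)"

lemma jost_wave_solves:
  "solves_with_deriv (\<lambda>x. of_real (poeschl_teller (real n + 1) x - k\<^sup>2))
     (jost_wave n k) (jost_wave_deriv n k)"
proof -
  define P where "P = jost_poly n"
  define Q where "Q = (1 - t_var\<^sup>2) * pderiv P + s_var * P"
  have "pderiv Q = (1 - t_var\<^sup>2) * pderiv (pderiv P) - 2 * t_var * pderiv P + s_var * pderiv P"
    by (simp add: Q_def pderiv_add pderiv_mult pderiv_diff power2_eq_square algebra_simps)
  moreover have "(1 - t_var\<^sup>2) * pderiv (pderiv P) + 2 * (s_var - t_var) * pderiv P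
     + of_nat (n * Suc n) * P = 0"
    unfolding P_def by (rule jost_poly_ode)
  \<comment> \<open>This is the polynomial form of the second derivative: \<open>1 - t^2\<close>
    times the equation in \<open>t\<close> leaves \<open>s^2 - n (n + 1) (1 - t^2)\<close>, which at
    \<open>s = ik\<close> and \<open>t = tanh x\<close> is \<open>V - k^2\<close>.\<close>
  ultimately have Q': "(1 - t_var\<^sup>2) * pderiv Q + s_var * Q =
      (s_var\<^sup>2 - of_nat (n * Suc n) * (1 - t_var\<^sup>2)) * P"
    unfolding Q_def by algebra
  have sech: "(1 / cosh x)\<^sup>2 = 1 - (tanh x)\<^sup>2" for x :: real
    using sinh_square_eq[of x] by (simp add: tanh_def field_simps)
  have V: "poeschl_teller (real n + 1) x = - real (n * Suc n) * (1 - (tanh x)\<^sup>2)" for x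
    unfolding poeschl_teller_def sech by (simp only: of_nat_mult of_nat_Suc) (simp add: algebra_simps)
  have "tanh_wave ((1 - t_var\<^sup>2) * pderiv Q + s_var * Q) k x =
      of_real (poeschl_teller (real n + 1) x - k\<^sup>2) * tanh_wave P k x" for x
    unfolding Q' tanh_wave_def V
    by (simp add: power_mult_distrib algebra_simps)
  then show ?thesis
    using has_vector_derivative_tanh_wave[of P k] has_vector_derivative_tanh_wave[of Q k]
    unfolding solves_with_deriv_def jost_wave_def jost_wave_deriv_def P_def[symmetric] Q_def[symmetric]
    by simp
qed

text \<open>Each factor \<open>ik - j\<close> or \<open>ik + j\<close> has real part of absolute
  value \<open>j \<ge> 1\<close>.\<close>

lemma poly2_jost_poly_nonzero:
  assumes "t = 1 \<or> t = -1"
  shows "poly2 (jost_poly n) t (\<i> * of_real k) \<noteq> 0"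
proof -
  have "\<i> * of_real k - of_nat j \<noteq> 0" "\<i> * of_real k + of_nat j \<noteq> 0" if "j \<in> {1..n}" for j
  proof -
    have "Re (\<i> * of_real k - of_nat j) \<noteq> 0" "Re (\<i> * of_real k + of_nat j) \<noteq> 0"
      using that by simp_all
    then show "\<i> * of_real k - of_nat j \<noteq> 0" "\<i> * of_real k + of_nat j \<noteq> 0"
      by (metis zero_complex.sel(1))+
  qed
  then show ?thesis
    using assms by (auto simp: poly2_jost_poly_1 poly2_jost_poly_minus_1 simp del: One_nat_def)
qed

text \<open>The exponentials cancel, leaving a function of \<open>tanh x\<close>. As
  \<open>x\<close> tends to infinity the terms with \<open>1 - t^2\<close> vanish, and the limit is
  \<open>-2ik p(1, ik) p(1, -ik)\<close>, which is nonzero.\<close>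

lemma jost_wronskian_nonzero:
  assumes "k \<noteq> 0"
  obtains x where "jost_wave n k x * jost_wave_deriv n (- k) x
    - jost_wave_deriv n k x * jost_wave n (- k) x \<noteq> 0"
proof -
  let ?s = "\<i> * of_real k"
  define p where "p = jost_poly n"
  define q where "q = (1 - t_var\<^sup>2) * pderiv p + s_var * p"
  define w where "w = (\<lambda>x. poly2 p (of_real (tanh x)) ?s * poly2 q (of_real (tanh x)) (- ?s)
      - poly2 q (of_real (tanh x)) ?s * poly2 p (of_real (tanh x)) (- ?s))"
  have pw: "plane_wave k x * plane_wave (- k) x = 1" for x
    by (simp add: plane_wave_def flip: exp_add)
  have W: "jost_wave n k x * jost_wave_deriv n (- k) x
      - jost_wave_deriv n k x * jost_wave n (- k) x = w x" for x
    unfolding w_def jost_wave_def jost_wave_deriv_def p_def[symmetric] q_def[symmetric] tanh_wave_def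
    using pw[of x] by simp algebra
  have "((\<lambda>x. complex_of_real (tanh x)) \<longlongrightarrow> 1) at_top"
    using tendsto_of_real[OF tanh_real_at_top] by simp
  then have "(w \<longlongrightarrow> poly2 p 1 ?s * poly2 q 1 (- ?s) - poly2 q 1 ?s * poly2 p 1 (- ?s)) at_top"
    unfolding w_def by (intro tendsto_intros tendsto_poly2)
  moreover have "poly2 p 1 ?s * poly2 q 1 (- ?s) - poly2 q 1 ?s * poly2 p 1 (- ?s) \<noteq> 0"
    using assms poly2_jost_poly_nonzero[of 1 n k] poly2_jost_poly_nonzero[of 1 n "-k"]
    by (simp add: q_def p_def)
  ultimately have "w \<noteq> (\<lambda>_. 0)"
    by (auto simp: tendsto_const_iff)
  then show thesis using that W by fastforce
qed

section \<open>Determination of the scattering solution\<close>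

lemma tanh_transmitted_end: "k \<noteq> 0 \<Longrightarrow> (tanh \<longlongrightarrow> sgn k) (transmitted_end k)"
  and tanh_incident_end: "k \<noteq> 0 \<Longrightarrow> (tanh \<longlongrightarrow> - sgn k) (incident_end k)"
  using tanh_real_at_top tanh_real_at_bot
  by (auto simp: transmitted_end_def incident_end_def sgn_if)

text \<open>Here \<open>c\<close> is the amplitude of the Jost wave at the incident end; dividing by
  it normalizes the incoming wave to amplitude one.\<close>

lemma scattering_solution_iff:
  fixes n :: nat and k :: real
  assumes k: "k \<noteq> 0"
  defines "c \<equiv> poly2 (jost_poly n) (of_real (- sgn k)) (\<i> * of_real k)"
  shows "scattering_solution (real n + 1) k f T R \<longleftrightarrow>
    f = (\<lambda>x. jost_wave n k x / c) \<and>
    T = poly2 (jost_poly n) (of_real (sgn k)) (\<i> * of_real k) / c \<and> R = 0"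
proof -
  define P where "P = (\<lambda>\<tau> k. poly2 (jost_poly n) (of_real \<tau>) (\<i> * of_real k))"
  have P0: "P \<tau> l \<noteq> 0" if "\<tau> = sgn k \<or> \<tau> = - sgn k" for \<tau> l
    unfolding P_def using that k by (intro poly2_jost_poly_nonzero) (auto simp: sgn_if split: if_splits)
  have c: "c = P (- sgn k) k" by (simp add: c_def P_def)
  have ends: "transmitted_end k = at_top \<or> transmitted_end k = at_bot"
    "incident_end k = at_top \<or> incident_end k = at_bot"
    by (auto simp: transmitted_end_def incident_end_def)
  let ?q = "\<lambda>x. complex_of_real (poeschl_teller (real n + 1) x - k\<^sup>2)"
  \<comment> \<open>The wave number \<open>l\<close> is free while the ends stay those of
    \<open>k\<close>, since the waves for \<open>k\<close> and \<open>-k\<close> are compared at the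
    same end.\<close>
  have asym: "((\<lambda>x. jost_wave n l x - P (sgn k) l * plane_wave l x) \<longlongrightarrow> 0) (transmitted_end k)"
     "((\<lambda>x. jost_wave n l x - P (- sgn k) l * plane_wave l x) \<longlongrightarrow> 0) (incident_end k)" for l
    unfolding P_def jost_wave_def
    by (intro tanh_wave_asymptotics tanh_transmitted_end tanh_incident_end k)+
  have sol: "solves_with_deriv ?q (jost_wave n k) (jost_wave_deriv n k)"
    "solves_with_deriv ?q (jost_wave n (- k)) (jost_wave_deriv n (- k))"
    using jost_wave_solves[of n k] jost_wave_solves[of n "- k"] by simp_all
  have P_sgn: "poly2 (jost_poly n) (of_real (sgn k)) (\<i> * of_real k) = P (sgn k) k"
    by (simp add: P_def)
  show ?thesis
    unfolding P_sgn
  proof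
    assume S: "scattering_solution (real n + 1) k f T R"
    then obtain f' where "solves_with_deriv ?q f f'"
      unfolding scattering_solution_def schroedinger_eigenfunction_iff by blast
    moreover obtain x0 where "jost_wave n k x0 * jost_wave_deriv n (- k) x0
        - jost_wave_deriv n k x0 * jost_wave n (- k) x0 \<noteq> 0"
      using jost_wronskian_nonzero[OF k, of n] by blast
    ultimately obtain a b where f: "\<And>x. f x = a * jost_wave n k x + b * jost_wave n (- k) x"
      using solution_span[OF sol, of f f' x0] by blast
    have tr: "((\<lambda>x. f x - T * plane_wave k x) \<longlongrightarrow> 0) (transmitted_end k)"
      and inc: "((\<lambda>x. f x - (plane_wave k x + R * plane_wave (- k) x)) \<longlongrightarrow> 0) (incident_end k)"
      using S by (auto simp: scattering_solution_def)
    \<comment> \<open>Two asymptotic forms of \<open>f\<close> at the transmitted end are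
      subtracted. The absence of a wave with number \<open>-k\<close> there forces
      \<open>b = 0\<close>.\<close>
    from tendsto_diff[OF tendsto_add[OF tendsto_mult_left[OF asym(1)[of k], of a]
        tendsto_mult_left[OF asym(1)[of "- k"], of b]] tr]
    have "((\<lambda>x. (T - a * P (sgn k) k) * plane_wave k x
        + (- b * P (sgn k) (- k)) * plane_wave (- k) x) \<longlongrightarrow> 0) (transmitted_end k)"
      by (simp add: f algebra_simps)
    from plane_wave_combination_tendsto_0[OF k ends(1) this]
    have T: "T = a * P (sgn k) k" and b: "b = 0" using P0 by auto
    \<comment> \<open>With \<open>b = 0\<close>, the same comparison at the incident end fixes
      \<open>a\<close> by the normalization and rules out reflection.\<close>
    from tendsto_diff[OF inc tendsto_mult_left[OF asym(2)[of k], of a]]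
    have "((\<lambda>x. (a * c - 1) * plane_wave k x + (- R) * plane_wave (- k) x) \<longlongrightarrow> 0) (incident_end k)"
      by (simp add: f b c algebra_simps)
    from plane_wave_combination_tendsto_0[OF k ends(2) this]
    have "R = 0" "a * c = 1" by auto
    moreover have "a = 1 / c" using \<open>a * c = 1\<close> by (metis mult_zero_right nonzero_eq_divide_eq zero_neq_one)
    ultimately show "f = (\<lambda>x. jost_wave n k x / c) \<and> T = P (sgn k) k / c \<and> R = 0"
      using T b f by auto
  next
    assume fTR: "f = (\<lambda>x. jost_wave n k x / c) \<and> T = P (sgn k) k / c \<and> R = 0"
    have "schroedinger_eigenfunction (poeschl_teller (real n + 1)) (k\<^sup>2) f"
      unfolding schroedinger_eigenfunction_iff
      using solves_with_deriv_cmult[OF sol(1), of "1 / c"] fTR by auto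
    moreover have "f x - P \<tau> k / c * plane_wave k x = (jost_wave n k x - P \<tau> k * plane_wave k x) / c" for x \<tau>
      using fTR by (simp add: diff_divide_distrib)
    note this[of _ "sgn k"] this[of _ "- sgn k"]
    moreover have "P (- sgn k) k / c = 1"
      using P0 c by simp
    ultimately show "scattering_solution (real n + 1) k f T R"
      using tendsto_divide_zero[OF asym(1)[of k], of c] tendsto_divide_zero[OF asym(2)[of k], of c] fTR
      unfolding scattering_solution_def by simp
  qed
qed

theorem lemma1p3:
  fixes lam :: real and n :: nat
  assumes "lam = real n + 1"
  shows "(\<forall>k. k \<noteq> 0 \<longrightarrow> (\<exists>!(f, T, R). scattering_solution lam k f T R)) \<and>
    (\<exists>(p :: complex poly poly) (A_plus :: real \<Rightarrow> complex) (A_minus :: real \<Rightarrow> complex).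
       degree_fst p = n \<and> degree_snd p = n \<and>
       (\<forall>k > 0. \<forall>x. scattering_wave lam x k =
          A_plus k * poly2 p (of_real (tanh x)) (\<i> * of_real k) * exp (\<i> * of_real k * of_real x)) \<and>
       (\<forall>k < 0. \<forall>x. scattering_wave lam x k =
          A_minus k * poly2 p (of_real (tanh x)) (\<i> * of_real k) * exp (\<i> * of_real k * of_real x)) \<and>
       (\<forall>k > 0. A_plus k = (\<Prod>j=1..n. 1 / (of_nat j + \<i> * of_real k))) \<and>
       (\<forall>k < 0. A_minus k = (-1) ^ n * (\<Prod>j=1..n. 1 / (of_nat j - \<i> * of_real k)))) \<and>
    (\<forall>k > 0. transmission_coeff lam k =
       (-1) ^ n * (\<Prod>j=1..n. (of_nat j - \<i> * of_real k) / (of_nat j + \<i> * of_real k))) \<and>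
    (\<forall>k < 0. transmission_coeff lam k =
       (-1) ^ n * (\<Prod>j=1..n. (of_nat j + \<i> * of_real k) / (of_nat j - \<i> * of_real k))) \<and>
    (\<forall>k. k \<noteq> 0 \<longrightarrow> reflection_coeff lam k = 0)"
proof -
  define P where "P = (\<lambda>\<tau> k. poly2 (jost_poly n) (of_real \<tau>) (\<i> * of_real k))"
  have iff: "scattering_solution lam k f T R \<longleftrightarrow>
      f = (\<lambda>x. jost_wave n k x / P (- sgn k) k) \<and> T = P (sgn k) k / P (- sgn k) k \<and> R = 0"
    if "k \<noteq> 0" for k f T R
    unfolding assms P_def using that by (rule scattering_solution_iff)
  have unique: "\<exists>!(f, T, R). scattering_solution lam k f T R" if "k \<noteq> 0" for k
    by (rule ex1I[of _ "(\<lambda>x. jost_wave n k x / P (- sgn k) k, P (sgn k) k / P (- sgn k) k, 0)"])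
       (auto simp: iff[OF that])
  \<comment> \<open>By \<open>iff\<close> the solution and both coefficients are unique, so the
    definite descriptions evaluate to the explicit values.\<close>
  have wave: "scattering_wave lam x k = jost_wave n k x / P (- sgn k) k"
    and trans: "transmission_coeff lam k = P (sgn k) k / P (- sgn k) k"
    and refl: "reflection_coeff lam k = 0" if "k \<noteq> 0" for k x
    by (simp_all add: scattering_wave_def transmission_coeff_def reflection_coeff_def iff[OF that])
  have P_1: "P 1 k = (-1) ^ n * (\<Prod>j=1..n. of_nat j - \<i> * of_real k)" for k
  proof -
    have "P 1 k = (\<Prod>j=1..n. (-1) * (of_nat j - \<i> * of_real k))"
      by (simp add: P_def poly2_jost_poly_1)
    then show ?thesis by (simp only: prod.distrib) simp
  qed
  have P_m1: "P (-1) k = (\<Prod>j=1..n. of_nat j + \<i> * of_real k)" for k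
    by (simp add: P_def poly2_jost_poly_minus_1 add.commute)
  \<comment> \<open>The sign \<open>(-1)^n\<close> is its own inverse; for \<open>k < 0\<close> it
    occurs in the denominator, where \<open>P 1 k\<close> is the incident amplitude.\<close>
  have sign: "a / ((-1) ^ n * b) = (-1) ^ n * (a / b)" for a b :: complex
    by (cases "even n") simp_all
  \<comment> \<open>Both constants are reciprocals of the incident amplitude,
    \<open>P (-1) k\<close> for \<open>k > 0\<close> and \<open>P 1 k\<close> for
    \<open>k < 0\<close>.\<close>
  define A_plus where "A_plus = (\<lambda>k. \<Prod>j=1..n. 1 / (of_nat j + \<i> * complex_of_real k))"
  define A_minus where "A_minus = (\<lambda>k. (-1) ^ n * (\<Prod>j=1..n. 1 / (of_nat j - \<i> * complex_of_real k)))"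
  have plus: "scattering_wave lam x k =
      A_plus k * poly2 (jost_poly n) (of_real (tanh x)) (\<i> * of_real k) * exp (\<i> * of_real k * of_real x)"
    if "k > 0" for k x
    using that by (simp add: wave P_m1 A_plus_def jost_wave_def tanh_wave_def plane_wave_def prod_dividef)
  have minus: "scattering_wave lam x k =
      A_minus k * poly2 (jost_poly n) (of_real (tanh x)) (\<i> * of_real k) * exp (\<i> * of_real k * of_real x)"
    if "k < 0" for k x
    using that
    by (simp add: wave P_1 sign A_minus_def jost_wave_def tanh_wave_def plane_wave_def prod_dividef)
  have "transmission_coeff lam k =
       (-1) ^ n * (\<Prod>j=1..n. (of_nat j - \<i> * of_real k) / (of_nat j + \<i> * of_real k))" if "k > 0" for k
    using that by (simp add: trans P_1 P_m1 prod_dividef)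
  moreover have "transmission_coeff lam k =
       (-1) ^ n * (\<Prod>j=1..n. (of_nat j + \<i> * of_real k) / (of_nat j - \<i> * of_real k))" if "k < 0" for k
    using that by (simp add: trans P_1 P_m1 sign prod_dividef)
  moreover have "\<exists>(p :: complex poly poly) (A_plus :: real \<Rightarrow> complex) (A_minus :: real \<Rightarrow> complex).
       degree_fst p = n \<and> degree_snd p = n \<and>
       (\<forall>k > 0. \<forall>x. scattering_wave lam x k =
          A_plus k * poly2 p (of_real (tanh x)) (\<i> * of_real k) * exp (\<i> * of_real k * of_real x)) \<and>
       (\<forall>k < 0. \<forall>x. scattering_wave lam x k =
          A_minus k * poly2 p (of_real (tanh x)) (\<i> * of_real k) * exp (\<i> * of_real k * of_real x)) \<and>
       (\<forall>k > 0. A_plus k = (\<Prod>j=1..n. 1 / (of_nat j + \<i> * of_real k))) \<and>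
       (\<forall>k < 0. A_minus k = (-1) ^ n * (\<Prod>j=1..n. 1 / (of_nat j - \<i> * of_real k)))"
    by (intro exI[of _ "jost_poly n"] exI[of _ A_plus] exI[of _ A_minus] conjI allI impI
        degree_fst_jost_poly degree_snd_jost_poly plus minus)
       (simp_all add: A_plus_def A_minus_def)
  ultimately show ?thesis
    using unique refl by blast
qed

end
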